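(* Let $0\le n\le m$ and $0\le s,r\le n$ be integers. For a prime power $q$ let $\varPhi_{n,m}(s,r)$ be the canonical matrix element of the pair $(\operatorname{Mat}_{n,m}(\mathbb{F}),\operatorname{GL}_n(\mathbb{F})\times\operatorname{GL}_m(\mathbb{F}))$ over the finite field $\mathbb{F}$ of order $q$. (1) $\varPhi_{n,m}(s,r)$ is a polynomial in $q$ with integer coefficients (i.e. there is a polynomial in $\mathbb{Z}[X]$, depending only on $n,m,s,r$, whose value at $X=q$ is $\varPhi_{n,m}(s,r)$ for every prime power $q$). (2) As $q\to1$ in this polynomial, $\varPhi_{n,m}(s,r)\to(-1)^r\binom sr$ if $r\le s$, and $\varPhi_{n,m}(s,r)\to0$ otherwise.
   Context: Let $\mathbb{F}$ be a finite field of order $q$ and $\theta$ a non-trivial additive character of $\mathbb{F}$. $\operatorname{Mat}_{n,m}(\mathbb{F})$ is the additive group of $n\times m$ matrices over $\mathbb{F}$, with $\operatorname{GL}_n(\mathbb{F})\times\operatorname{GL}_m(\mathbb{F})$ acting by $(g,h)\cdot a=ga\,{}^th$, and $\langle a|b\rangle=\operatorname{trace}({}^tab)$. The canonical matrix is $$\varPhi_{n,m}(s,r)=\sum_{b\in\operatorname{Mat}_{n,m}(\mathbb{F}),\ \operatorname{rank}b=r}\overline{\theta(\langle a|b\rangle)},\qquad a\text{ any matrix with }\operatorname{rank}a=s$$ (independent of the choice of $a$). *)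

theory Defs
  imports
    "HOL-Analysis.Analysis"
    "HOL-Computational_Algebra.Polynomial"
    "HOL-Algebra.Ring"
    "HOL-Algebra.Coset"
    "Jordan_Normal_Form.Missing_VectorSpace"
    "Jordan_Normal_Form.Matrix"
begin

text \<open>
  The polynomial must not depend on the finite field, so the field has to be quantified inside the
  formula. Fields are therefore HOL-Algebra records. The type of \<^typ>\<open>'k mat\<close> is used only as a
  container of entries; its arithmetic, which needs type class instances, is replaced by
  operations relative to the field \<open>F\<close>.
\<close>

definition Mat :: "'k ring \<Rightarrow> nat \<Rightarrow> nat \<Rightarrow> 'k mat set" where
  "Mat F n m = {a \<in> carrier_mat n m. elements_mat a \<subseteq> carrier F}"

definition mat_mult_over :: "'k ring \<Rightarrow> 'k mat \<Rightarrow> 'k mat \<Rightarrow> 'k mat" where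
  "mat_mult_over F a b = mat (dim_row a) (dim_col b)
     (\<lambda>(i, j). \<Oplus>\<^bsub>F\<^esub>k\<in>{..<dim_row b}. a $$ (i, k) \<otimes>\<^bsub>F\<^esub> b $$ (k, j))"

definition trace_over :: "'k ring \<Rightarrow> 'k mat \<Rightarrow> 'k" where
  "trace_over F a = (\<Oplus>\<^bsub>F\<^esub>i\<in>{..<dim_row a}. a $$ (i, i))"

definition pairing :: "'k ring \<Rightarrow> 'k mat \<Rightarrow> 'k mat \<Rightarrow> 'k" where
  "pairing F a b = trace_over F (mat_mult_over F (transpose_mat a) b)"

text \<open>
  Columns are turned into elements of the function space \<open>{..<n} \<rightarrow>\<^sub>E carrier F\<close>, the library's
  \<open>F\<^sup>n\<close> over a record field; the rank is the dimension of their span.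
\<close>

definition column_space :: "'k ring \<Rightarrow> 'k mat \<Rightarrow> (nat \<Rightarrow> 'k) set" where
  "column_space F a =
     LinearCombinations.module.span F (LinearCombinations.ring.func_space F {..<dim_row a})
       ((\<lambda>j. \<lambda>i\<in>{..<dim_row a}. a $$ (i, j)) ` {..<dim_col a})"

definition rank_over :: "'k ring \<Rightarrow> 'k mat \<Rightarrow> nat" where
  "rank_over F a = vectorspace.dim F
     ((LinearCombinations.ring.func_space F {..<dim_row a})\<lparr>carrier := column_space F a\<rparr>)"

definition nontrivial_additive_character :: "'k ring \<Rightarrow> ('k \<Rightarrow> complex) \<Rightarrow> bool" where
  "nontrivial_additive_character F \<theta> \<longleftrightarrow>
     (\<forall>x\<in>carrier F. cmod (\<theta> x) = 1) \<and>
     (\<forall>x\<in>carrier F. \<forall>y\<in>carrier F. \<theta> (x \<oplus>\<^bsub>F\<^esub> y) = \<theta> x * \<theta> y) \<and>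
     (\<exists>x\<in>carrier F. \<theta> x \<noteq> 1)"

text \<open>
  The common value of the sum over all \<open>a\<close> of rank \<open>s\<close>. It is a specified number only if such an
  \<open>a\<close> exists and the sum does not depend on its choice.
\<close>

definition canonical_matrix ::
  "'k ring \<Rightarrow> ('k \<Rightarrow> complex) \<Rightarrow> nat \<Rightarrow> nat \<Rightarrow> nat \<Rightarrow> nat \<Rightarrow> complex" where
  "canonical_matrix F \<theta> n m s r =
     (THE z. \<forall>a\<in>Mat F n m. rank_over F a = s \<longrightarrow>
        (\<Sum>b | b \<in> Mat F n m \<and> rank_over F b = r. cnj (\<theta> (pairing F a b))) = z)"

end

theory Submission
  imports Defs
begin

text \<open>
  The pairing is \<open>\<Sum>\<^sub>j dot a\<^sub>j b\<^sub>j\<close> over the columns, so more generally one sums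
  \<open>\<Prod>\<^sub>j \<psi> (f\<^sub>j b\<^sub>j)\<close> over the lists of vectors \<open>b\<^sub>j\<close> of rank \<open>r\<close> in a subspace \<open>W\<close> with \<open>q\<^sup>d\<close> elements,
  for linear functionals \<open>f\<^sub>j\<close> whose restrictions to \<open>W\<close> have rank \<open>s\<close>, i.e. whose common kernel in \<open>W\<close>
  has \<open>q\<^sup>d / q\<^sup>s\<close> elements. Split off the first vector \<open>b\<close> and let \<open>U\<close> be the span of the others: either
  \<open>b \<in> U\<close> and \<open>U\<close> has dimension \<open>r\<close>, or \<open>b \<notin> U\<close> and \<open>U\<close> has dimension \<open>r - 1\<close>. If \<open>f\<close> vanishes on
  \<open>W\<close>, these choices of \<open>b\<close> contribute \<open>q\<^sup>r\<close> and \<open>q\<^sup>d - q\<^sup>r / q\<close>. Otherwise \<open>\<psi> \<circ> f\<close> sums to \<open>0\<close> over \<open>W\<close>, and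
  over \<open>U\<close> unless \<open>U\<close> lies in the kernel \<open>W'\<close> of \<open>f\<close>; so they contribute \<open>q\<^sup>r\<close> and \<open>- q\<^sup>r / q\<close>, the
  others are confined to \<open>W'\<close>, and \<open>d\<close> and \<open>s\<close> drop by one. At \<open>q = 1\<close> the second recursion is Pascal's
  rule for \<open>(-1)\<^sup>r * (s choose r)\<close>.
\<close>

section \<open>The recursion for the polynomials\<close>

text \<open>\<open>n\<close> counts the vectors, \<open>d\<close> is the dimension of the ambient
  subspace, \<open>s\<close> the rank of the functionals on it and \<open>r\<close> the rank of the
  vectors. The truncation in \<open>d - 1\<close> does no harm: a functional that is nonzero on the
  subspace forces \<open>d > 0\<close>.\<close>

fun rank_sum_poly :: "nat \<Rightarrow> nat \<Rightarrow> nat \<Rightarrow> nat \<Rightarrow> int poly" where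
  "rank_sum_poly 0 d s r = (if r = 0 then 1 else 0)"
| "rank_sum_poly (Suc n) d 0 r = monom 1 r * rank_sum_poly n d 0 r +
     (case r of 0 \<Rightarrow> 0 | Suc k \<Rightarrow> (monom 1 d - monom 1 k) * rank_sum_poly n d 0 k)"
| "rank_sum_poly (Suc n) d (Suc s) r = monom 1 r * rank_sum_poly n (d - 1) s r -
     (case r of 0 \<Rightarrow> 0 | Suc k \<Rightarrow> monom 1 k * rank_sum_poly n (d - 1) s k)"

text \<open>
  The first recursion extends to all \<open>s\<close>: this consistency is what makes the result depend only on
  the rank \<open>s\<close>, and not on which of the functionals vanish when they are split off.
\<close>
lemma rank_sum_poly_Suc:
  assumes "s \<le> n" and "s \<le> d"
  shows "rank_sum_poly (Suc n) d s r = monom 1 r * rank_sum_poly n d s r +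
     (case r of 0 \<Rightarrow> 0 | Suc k \<Rightarrow> (monom 1 d - monom 1 k) * rank_sum_poly n d s k)"
  using assms
proof (induction n arbitrary: d s r)
  case (Suc n)
  show ?case
  proof (cases s)
    case s: (Suc t)
    with Suc.prems obtain e where d: "d = Suc e" and "t \<le> n" "t \<le> e"
      by (cases d) auto
    note IH = Suc.IH[OF \<open>t \<le> n\<close> \<open>t \<le> e\<close>]
    define X :: "int poly" where "X = monom 1 1"
    have X: "monom 1 k = X ^ k" for k
      by (simp add: X_def monom_power)
    \<comment> \<open>Unfolding both recursions lowers \<open>r\<close> by up to two, so 0 and 1 are
      separated from the rest.\<close>
    consider "r = 0" | "r = 1" | k where "r = Suc (Suc k)"
      by (metis One_nat_def not0_implies_Suc)
    then show ?thesis
      unfolding s d rank_sum_poly.simps(3)[of "Suc n"] rank_sum_poly.simps(3)[of n]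
      by cases (simp_all add: IH X algebra_simps del: rank_sum_poly.simps)
  next
    case 0
    show ?thesis
      unfolding 0 by (rule rank_sum_poly.simps(2))
  qed
qed (auto split: nat.split)

text \<open>At 1 the factor \<open>monom 1 d - monom 1 k\<close> vanishes, so the recursion with
  \<open>s = 0\<close> keeps only its first term. The bound \<open>s \<le> n\<close> enters because
  the value for \<open>n = 0\<close> ignores \<open>s\<close>.\<close>

lemma poly_rank_sum_poly_1:
  assumes "s \<le> n"
  shows "poly (rank_sum_poly n d s r) 1 = (-1) ^ r * int (s choose r)"
  using assms
proof (induction n d s r rule: rank_sum_poly.induct)
  case (3 n d s r)
  then have "s \<le> n" by simp
  with 3 show ?case
    by (cases r) (simp_all add: poly_monom ring_distribs)
qed (auto simp: poly_monom split: nat.splits)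

section \<open>Character sums over lists of vectors of given rank\<close>

definition linear_functional :: "'k ring \<Rightarrow> ('k, 'v) module \<Rightarrow> ('v \<Rightarrow> 'k) \<Rightarrow> bool" where
  "linear_functional K V f \<longleftrightarrow> f \<in> carrier V \<rightarrow> carrier K \<and>
     (\<forall>v\<in>carrier V. \<forall>w\<in>carrier V. f (v \<oplus>\<^bsub>V\<^esub> w) = f v \<oplus>\<^bsub>K\<^esub> f w) \<and>
     (\<forall>c\<in>carrier K. \<forall>v\<in>carrier V. f (c \<odot>\<^bsub>V\<^esub> v) = c \<otimes>\<^bsub>K\<^esub> f v)"

text \<open>Reindexing along \<open>g\<close> multiplies the sum by \<open>c\<close>, and only 0 is
  fixed by a factor other than 1. It is applied with \<open>g\<close> a translation.\<close>

lemma translation_bij_imp_sum_eq_0: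
  fixes \<psi> :: "'a \<Rightarrow> complex"
  assumes "bij_betw g U U" and "\<And>u. u \<in> U \<Longrightarrow> \<psi> (g u) = c * \<psi> u" and "c \<noteq> 1"
  shows "(\<Sum>u\<in>U. \<psi> u) = 0"
proof -
  have "(\<Sum>u\<in>U. \<psi> u) = (\<Sum>u\<in>U. \<psi> (g u))"
    by (rule sum.reindex_bij_betw[OF assms(1), symmetric])
  also have "\<dots> = c * (\<Sum>u\<in>U. \<psi> u)"
    by (simp add: assms(2) sum_distrib_left)
  finally have "(\<Sum>u\<in>U. \<psi> u) = 0 \<or> c = 1"
    by (rule mult_cancel_right1[THEN iffD1])
  then show ?thesis
    using assms(3) by simp
qed

section \<open>Finite vector spaces: cardinality and rank of spans\<close>

locale finite_vectorspace = vectorspace K V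
  for K :: "'k ring" and V :: "('k, 'v) module" +
  assumes finite_field: "finite (carrier K)" and finite_space: "finite (carrier V)"
begin

abbreviation q :: nat where "q \<equiv> card (carrier K)"

definition rk :: "'v set \<Rightarrow> nat" where "rk S = vectorspace.dim K (vs (span S))"

lemma q_gt_1: "1 < q"
proof -
  have "card {\<zero>\<^bsub>K\<^esub>, \<one>\<^bsub>K\<^esub>} \<le> q"
    by (intro card_mono finite_field) auto
  then show ?thesis by simp
qed

lemma finite_submodule: "submodule K W V \<Longrightarrow> finite W"
  by (rule finite_subset[OF submodule.subset finite_space])

text \<open>Independence makes coefficients unique, so the span corresponds to the coefficient
  functions on \<open>B\<close>. These are extensional, since values outside \<open>B\<close> would
  spoil injectivity.\<close>

lemma card_span_lin_indpt:
  assumes "B \<subseteq> carrier V" and "lin_indpt B"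
  shows "card (span B) = q ^ card B"
proof -
  have B: "finite B"
    using assms finite_space finite_subset by blast
  have "bij_betw (\<lambda>a. lincomb a B) (B \<rightarrow>\<^sub>E carrier K) (span B)"
    unfolding bij_betw_def
  proof
    show "inj_on (\<lambda>a. lincomb a B) (B \<rightarrow>\<^sub>E carrier K)"
    proof (rule inj_onI)
      fix a b assume ab: "a \<in> B \<rightarrow>\<^sub>E carrier K" "b \<in> B \<rightarrow>\<^sub>E carrier K" "lincomb a B = lincomb b B"
      then have "lincomb (\<lambda>v. a v \<ominus>\<^bsub>K\<^esub> b v) B = lincomb a B \<ominus>\<^bsub>V\<^esub> lincomb b B"
        using B assms by (intro lincomb_diff) auto
      moreover have "lincomb b B \<in> carrier V"
        using ab assms by (intro lincomb_closed) auto
      then have "lincomb a B \<ominus>\<^bsub>V\<^esub> lincomb b B = \<zero>\<^bsub>V\<^esub>"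
        using ab(3) by (simp add: M.r_neg M.minus_eq)
      ultimately have *: "lincomb (\<lambda>v. a v \<ominus>\<^bsub>K\<^esub> b v) B = \<zero>\<^bsub>V\<^esub>" by simp
      have "(\<lambda>v. a v \<ominus>\<^bsub>K\<^esub> b v) \<in> B \<rightarrow> carrier K"
        using ab by (auto simp: PiE_mem)
      then have "a v \<ominus>\<^bsub>K\<^esub> b v = \<zero>\<^bsub>K\<^esub>" if "v \<in> B" for v
        using lin_dep_crit[OF B subset_refl _ that _ *] assms(2) by blast
      then have "a v = b v" if "v \<in> B" for v
        using that ab by (metis PiE_mem R.add.inv_closed R.minus_eq R.minus_equality R.minus_minus)
      then show "a = b"
        using ab by (intro PiE_ext)
    qed
    show "(\<lambda>a. lincomb a B) ` (B \<rightarrow>\<^sub>E carrier K) = span B"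
      unfolding finite_span[OF B assms(1)]
    proof safe
      fix a assume "a \<in> B \<rightarrow> carrier K"
      then show "lincomb a B \<in> (\<lambda>a. lincomb a B) ` (B \<rightarrow>\<^sub>E carrier K)"
        using assms by (intro image_eqI[of _ _ "restrict a B"] lincomb_cong) auto
    qed auto
  qed
  then show ?thesis
    using B by (simp add: card_PiE flip: bij_betw_same_card)
qed

text \<open>Linear independence in \<open>V\<close> and in the subspace \<open>vs (span B)\<close>
  agree, so \<open>B\<close> is a basis of the latter.\<close>

lemma rk_lin_indpt:
  assumes "B \<subseteq> carrier V" and "lin_indpt B"
  shows "rk B = card B"
proof -
  have B: "finite B"
    using assms finite_space finite_subset by blast
  have sub: "subspace K (span B) V"
    using assms by (intro span_is_subspace)
  interpret S: vectorspace K "vs (span B)"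
    using sub by (rule subspace_is_vs)
  have BS: "B \<subseteq> span B"
    using assms by (simp add: in_own_span)
  have "S.basis B"
    unfolding S.basis_def
    using assms BS sub span_li_not_depend[OF BS] by (auto simp: subspace_def)
  then show ?thesis
    using S.dim_basis[OF B] by (simp add: rk_def)
qed

lemma ex_basis_of_span:
  assumes "S \<subseteq> carrier V"
  shows "\<exists>B \<subseteq> carrier V. lin_indpt B \<and> span B = span S \<and> card B = rk S"
proof -
  have sub: "subspace K (span S) V"
    using assms by (intro span_is_subspace)
  interpret S: vectorspace K "vs (span S)"
    using sub by (rule subspace_is_vs)
  have fin: "finite (span S)"
    using sub by (simp add: finite_submodule)
  have "S.gen_set (span S)"
    using S.in_own_span[of "span S"] S.span_is_subset2[of "span S"] by auto
  \<comment> \<open>The span is finite and generates itself, which gives finite dimension before any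
    basis is known.\<close>
  then have "S.fin_dim"
    using fin unfolding S.fin_dim_def by (intro exI[of _ "span S"]) auto
  then obtain B where B: "finite B" "S.basis B"
    using S.finite_basis_exists by blast
  then have BS: "B \<subseteq> span S" by (simp add: S.basis_def)
  then have BV: "B \<subseteq> carrier V"
    using assms by auto
  have "lin_indpt B" "span B = span S"
    using B BS sub span_li_not_depend[OF BS] by (auto simp: S.basis_def)
  then show ?thesis
    using BV rk_lin_indpt[of B] by (auto simp: rk_def)
qed

lemma card_span:
  assumes "S \<subseteq> carrier V"
  shows "card (span S) = q ^ rk S"
  using ex_basis_of_span[OF assms] card_span_lin_indpt by metis

text \<open>After replacing \<open>S\<close> by a basis of its span, a vector outside the span
  extends that basis to an independent set.\<close>

lemma rk_insert:
  assumes "S \<subseteq> carrier V" and "b \<in> carrier V"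
  shows "rk (insert b S) = (if b \<in> span S then rk S else Suc (rk S))"
proof (cases "b \<in> span S")
  case True
  then show ?thesis
    using already_in_span[OF assms(1)] by (simp add: rk_def)
next
  case False
  obtain B where B: "B \<subseteq> carrier V" "lin_indpt B" "span B = span S" "card B = rk S"
    using ex_basis_of_span[OF assms(1)] by blast
  have nin: "b \<notin> B"
    using False B in_own_span by blast
  have "finite B"
    using B finite_space finite_subset by blast
  have "lin_indpt (insert b B)"
    using lin_dep_iff_in_span[OF B(1,2) assms(2) nin] False B by simp
  then have "rk (insert b B) = Suc (rk S)"
    using rk_lin_indpt[of "insert b B"] B assms nin \<open>finite B\<close> by simp
  moreover have "span (insert b B) = span (insert b S)"
    using span_Un[of B S "{b}" "{b}"] B assms by simp
  ultimately show ?thesis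
    using False by (simp add: rk_def)
qed

section \<open>Linear functionals and character sums over subspaces\<close>

lemma linear_functionalD:
  assumes "linear_functional K V f"
  shows "v \<in> carrier V \<Longrightarrow> f v \<in> carrier K"
    and "v \<in> carrier V \<Longrightarrow> w \<in> carrier V \<Longrightarrow> f (v \<oplus>\<^bsub>V\<^esub> w) = f v \<oplus>\<^bsub>K\<^esub> f w"
    and "c \<in> carrier K \<Longrightarrow> v \<in> carrier V \<Longrightarrow> f (c \<odot>\<^bsub>V\<^esub> v) = c \<otimes>\<^bsub>K\<^esub> f v"
    and "f \<zero>\<^bsub>V\<^esub> = \<zero>\<^bsub>K\<^esub>"
proof -
  show *: "f v \<in> carrier K" "w \<in> carrier V \<Longrightarrow> f (v \<oplus>\<^bsub>V\<^esub> w) = f v \<oplus>\<^bsub>K\<^esub> f w"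
    "c \<in> carrier K \<Longrightarrow> f (c \<odot>\<^bsub>V\<^esub> v) = c \<otimes>\<^bsub>K\<^esub> f v" if "v \<in> carrier V" for v w c
    using assms that by (auto simp: linear_functional_def)
  have "f \<zero>\<^bsub>V\<^esub> \<in> carrier K"
    by (intro *) simp
  then show "f \<zero>\<^bsub>V\<^esub> = \<zero>\<^bsub>K\<^esub>"
    using *(3)[of "\<zero>\<^bsub>V\<^esub>" "\<zero>\<^bsub>K\<^esub>"] by simp
qed

lemma submodule_kernel:
  assumes "submodule K W V" and "linear_functional K V f"
  shows "submodule K {w \<in> W. f w = \<zero>\<^bsub>K\<^esub>} V"
proof -
  interpret W: submodule K W V by fact
  show ?thesis
    by (rule submodule.intro[OF module_axioms])
      (use W.subset in \<open>auto simp: linear_functionalD[OF assms(2)] subset_iff\<close>)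
qed

lemma translation_bij_betw:
  assumes "submodule K U V" and w: "w \<in> U"
  shows "bij_betw (\<lambda>u. u \<oplus>\<^bsub>V\<^esub> w) U U"
proof -
  interpret U: submodule K U V by fact
  have "inj_on (\<lambda>u. u \<oplus>\<^bsub>V\<^esub> w) U"
  proof (rule inj_onI)
    fix a b assume ab: "a \<in> U" "b \<in> U" and eq: "a \<oplus>\<^bsub>V\<^esub> w = b \<oplus>\<^bsub>V\<^esub> w"
    from M.add.right_cancel[OF subsetD[OF U.subset w] ab[THEN subsetD[OF U.subset]]] eq
    show "a = b" by (rule iffD1)
  qed
  moreover have "(\<lambda>u. u \<oplus>\<^bsub>V\<^esub> w) ` U \<subseteq> U"
    using w by auto
  ultimately show ?thesis
    using endo_inj_surj[OF finite_submodule[OF assms(1)]] by (simp add: bij_betw_def)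
qed

lemma additive_character_zero:
  assumes "nontrivial_additive_character K \<psi>"
  shows "\<psi> \<zero>\<^bsub>K\<^esub> = 1"
proof -
  have "\<psi> (\<zero>\<^bsub>K\<^esub> \<oplus>\<^bsub>K\<^esub> \<zero>\<^bsub>K\<^esub>) = \<psi> \<zero>\<^bsub>K\<^esub> * \<psi> \<zero>\<^bsub>K\<^esub>" and "cmod (\<psi> \<zero>\<^bsub>K\<^esub>) = 1"
    using assms unfolding nontrivial_additive_character_def by blast+
  then have "\<psi> \<zero>\<^bsub>K\<^esub> = \<psi> \<zero>\<^bsub>K\<^esub> * \<psi> \<zero>\<^bsub>K\<^esub>" and "\<psi> \<zero>\<^bsub>K\<^esub> \<noteq> 0"
    by auto
  then show ?thesis
    by (metis mult_cancel_left1)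
qed

text \<open>If \<open>f\<close> is not zero on \<open>U\<close>, it takes every value of the field
  there, in particular one on which the character is not 1; translation by such a vector kills the
  sum.\<close>

lemma sum_character_functional:
  assumes \<psi>: "nontrivial_additive_character K \<psi>" and "submodule K U V" and f: "linear_functional K V f"
  shows "(\<Sum>u\<in>U. \<psi> (f u)) = (if \<forall>u\<in>U. f u = \<zero>\<^bsub>K\<^esub> then of_nat (card U) else 0)"
proof (cases "\<forall>u\<in>U. f u = \<zero>\<^bsub>K\<^esub>")
  case True
  then show ?thesis
    by (simp add: additive_character_zero[OF \<psi>])
next
  case False
  interpret U: submodule K U V by fact
  from False obtain u where u: "u \<in> U" "f u \<noteq> \<zero>\<^bsub>K\<^esub>" by blast
  obtain x where x: "x \<in> carrier K" "\<psi> x \<noteq> 1"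
    using \<psi> by (auto simp: nontrivial_additive_character_def)
  have uV: "u \<in> carrier V" and fu: "f u \<in> carrier K"
    using u U.subset linear_functionalD(1)[OF f] by auto
  then have inv: "inv\<^bsub>K\<^esub> f u \<in> carrier K" "inv\<^bsub>K\<^esub> f u \<otimes>\<^bsub>K\<^esub> f u = \<one>\<^bsub>K\<^esub>"
    using u(2) by (auto simp: field_Units)
  define w where "w = (x \<otimes>\<^bsub>K\<^esub> inv\<^bsub>K\<^esub> f u) \<odot>\<^bsub>V\<^esub> u"
  have w: "w \<in> U" and wV: "w \<in> carrier V"
    using u uV inv x by (auto simp: w_def)
  have fw: "f w = x"
    using x inv uV fu by (simp add: w_def linear_functionalD[OF f] R.m_assoc)
  have "\<psi> (f (v \<oplus>\<^bsub>V\<^esub> w)) = \<psi> x * \<psi> (f v)" if "v \<in> U" for v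
  proof -
    have "v \<in> carrier V" using that U.subset by auto
    then show ?thesis
      using \<psi> x wV by (simp add: linear_functionalD[OF f] fw nontrivial_additive_character_def)
  qed
  then have "(\<Sum>u\<in>U. \<psi> (f u)) = 0"
    by (rule translation_bij_imp_sum_eq_0[OF translation_bij_betw[OF assms(2) w] _ x(2)])
  then show ?thesis
    by (simp only: False if_False)
qed

text \<open>The same translation argument for multiplication by \<open>x\<close>, whose domain is
  the field itself and not a subspace of \<open>V\<close>.\<close>

lemma sum_character_field:
  assumes \<psi>: "nontrivial_additive_character K \<psi>" and x: "x \<in> carrier K"
  shows "(\<Sum>c\<in>carrier K. \<psi> (c \<otimes>\<^bsub>K\<^esub> x)) = (if x = \<zero>\<^bsub>K\<^esub> then of_nat q else 0)"
proof (cases "x = \<zero>\<^bsub>K\<^esub>")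
  case True
  then show ?thesis
    by (simp add: additive_character_zero[OF \<psi>])
next
  case False
  obtain y where y: "y \<in> carrier K" "\<psi> y \<noteq> 1"
    using \<psi> by (auto simp: nontrivial_additive_character_def)
  have inv: "inv\<^bsub>K\<^esub> x \<in> carrier K" "inv\<^bsub>K\<^esub> x \<otimes>\<^bsub>K\<^esub> x = \<one>\<^bsub>K\<^esub>"
    using x False by (auto simp: field_Units)
  define w where "w = y \<otimes>\<^bsub>K\<^esub> inv\<^bsub>K\<^esub> x"
  have w: "w \<in> carrier K" and wx: "w \<otimes>\<^bsub>K\<^esub> x = y"
    using x y inv by (auto simp: w_def R.m_assoc)
  have "inj_on (\<lambda>u. u \<oplus>\<^bsub>K\<^esub> w) (carrier K)"
    using w by (intro inj_onI) (metis R.add.right_cancel)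
  moreover have "(\<lambda>u. u \<oplus>\<^bsub>K\<^esub> w) ` carrier K \<subseteq> carrier K"
    using w by auto
  ultimately have "bij_betw (\<lambda>u. u \<oplus>\<^bsub>K\<^esub> w) (carrier K) (carrier K)"
    using endo_inj_surj[OF finite_field] by (simp add: bij_betw_def)
  moreover have "\<psi> ((v \<oplus>\<^bsub>K\<^esub> w) \<otimes>\<^bsub>K\<^esub> x) = \<psi> y * \<psi> (v \<otimes>\<^bsub>K\<^esub> x)" if "v \<in> carrier K" for v
    using that \<psi> x y w by (simp add: R.l_distr wx nontrivial_additive_character_def)
  ultimately have "(\<Sum>c\<in>carrier K. \<psi> (c \<otimes>\<^bsub>K\<^esub> x)) = 0"
    using y(2) by (rule translation_bij_imp_sum_eq_0)
  then show ?thesis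
    using False by simp
qed

text \<open>The double sum of \<psi>(c f(v)) over scalars c and vectors v is evaluated in two ways:
  summed over v first, only c = 0 survives and gives \<open>card W\<close>; summed over c first,
  only the kernel survives, with weight \<open>q\<close>.\<close>

lemma card_kernel:
  assumes \<psi>: "nontrivial_additive_character K \<psi>" and "submodule K W V" and f: "linear_functional K V f"
    and w: "w \<in> W" "f w \<noteq> \<zero>\<^bsub>K\<^esub>"
  shows "card W = q * card {w \<in> W. f w = \<zero>\<^bsub>K\<^esub>}"
proof -
  interpret W: submodule K W V by fact
  have fW: "f v \<in> carrier K" if "v \<in> W" for v
    using that W.subset linear_functionalD(1)[OF f] by auto
  have "linear_functional K V (\<lambda>v. c \<otimes>\<^bsub>K\<^esub> f v)" if "c \<in> carrier K" for c
    using that linear_functionalD[OF f]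
    by (auto simp: linear_functional_def R.r_distr R.m_lcomm)
  then have "(\<Sum>v\<in>W. \<psi> (c \<otimes>\<^bsub>K\<^esub> f v)) = (if c = \<zero>\<^bsub>K\<^esub> then of_nat (card W) else 0)"
    if "c \<in> carrier K" for c
    using sum_character_functional[OF \<psi> assms(2)] that w fW integral_iff by auto
  then have "of_nat (card W) = (\<Sum>c\<in>carrier K. \<Sum>v\<in>W. \<psi> (c \<otimes>\<^bsub>K\<^esub> f v))"
    using finite_field by simp
  also have "\<dots> = (\<Sum>v\<in>W. \<Sum>c\<in>carrier K. \<psi> (c \<otimes>\<^bsub>K\<^esub> f v))"
    by (rule sum.swap)
  also have "\<dots> = (\<Sum>v\<in>W. if f v = \<zero>\<^bsub>K\<^esub> then of_nat q else 0)"
    using fW by (intro sum.cong sum_character_field[OF \<psi>]) auto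
  also have "\<dots> = of_nat (q * card {w \<in> W. f w = \<zero>\<^bsub>K\<^esub>})"
    using finite_submodule[OF assms(2)] by (simp add: sum.If_cases Collect_conj_eq[symmetric] Int_def)
  finally show ?thesis
    by (simp only: of_nat_eq_iff)
qed

text \<open>Each functional shrinks a subspace by a factor of at most \<open>q\<close>. In the main
  induction this bounds the rank \<open>s\<close> by the number of functionals, as
  \<open>rank_sum_poly_Suc\<close> requires.\<close>

lemma card_common_kernel:
  assumes \<psi>: "nontrivial_additive_character K \<psi>"
  shows "submodule K W V \<Longrightarrow> (\<forall>f\<in>set fs. linear_functional K V f) \<Longrightarrow>
    card W \<le> q ^ length fs * card {w \<in> W. \<forall>f\<in>set fs. f w = \<zero>\<^bsub>K\<^esub>}"
proof (induction fs arbitrary: W)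
  case (Cons f fs)
  let ?W = "{w \<in> W. f w = \<zero>\<^bsub>K\<^esub>}"
  have "card W \<le> q * card ?W"
  proof (cases "\<forall>w\<in>W. f w = \<zero>\<^bsub>K\<^esub>")
    case True
    then have "?W = W" by auto
    then show ?thesis using q_gt_1 by simp
  next
    case False
    then show ?thesis
      using card_kernel[OF \<psi> Cons.prems(1), of f] Cons.prems by auto
  qed
  also have "card ?W \<le> q ^ length fs * card {w \<in> ?W. \<forall>f\<in>set fs. f w = \<zero>\<^bsub>K\<^esub>}"
    using Cons.prems by (intro Cons.IH submodule_kernel) auto
  also have "{w \<in> ?W. \<forall>f\<in>set fs. f w = \<zero>\<^bsub>K\<^esub>} = {w \<in> W. \<forall>f\<in>set (f # fs). f w = \<zero>\<^bsub>K\<^esub>}"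
    by auto
  finally show ?case
    by (simp add: mult.assoc)
qed simp

section \<open>Rank sums and their recursion\<close>

definition rank_sum :: "('k \<Rightarrow> complex) \<Rightarrow> ('v \<Rightarrow> 'k) list \<Rightarrow> 'v set \<Rightarrow> nat \<Rightarrow> complex" where
  "rank_sum \<psi> fs W r = (\<Sum>bs | set bs \<subseteq> W \<and> length bs = length fs \<and> rk (set bs) = r.
     prod_list (map2 (\<lambda>f b. \<psi> (f b)) fs bs))"

text \<open>For a fixed tail \<open>bs\<close>, a first vector in the span of the tail keeps the
  rank and one in the rest of \<open>W\<close> raises it by one; the sum over that rest is written
  as a difference. Both recursions specialise this identity.\<close>

lemma rank_sum_Cons:
  assumes "submodule K W V"
  shows "rank_sum \<psi> (f # fs) W r =
    (\<Sum>bs | set bs \<subseteq> W \<and> length bs = length fs \<and> rk (set bs) = r.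
       (\<Sum>b\<in>span (set bs). \<psi> (f b)) * prod_list (map2 (\<lambda>f b. \<psi> (f b)) fs bs)) +
    (case r of 0 \<Rightarrow> 0 | Suc k \<Rightarrow>
      (\<Sum>bs | set bs \<subseteq> W \<and> length bs = length fs \<and> rk (set bs) = k.
        ((\<Sum>b\<in>W. \<psi> (f b)) - (\<Sum>b\<in>span (set bs). \<psi> (f b))) *
          prod_list (map2 (\<lambda>f b. \<psi> (f b)) fs bs)))"
proof -
  interpret W: submodule K W V by fact
  have finW: "finite W"
    by (rule finite_submodule[OF assms])
  define L where "L = {bs. set bs \<subseteq> W \<and> length bs = length fs}"
  have finL: "finite L"
    unfolding L_def by (rule finite_lists_length_eq[OF finW])
  let ?T = "\<lambda>bs. prod_list (map2 (\<lambda>f b. \<psi> (f b)) fs bs)"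
  have inner: "(\<Sum>b\<in>W. if rk (insert b (set bs)) = r then \<psi> (f b) * ?T bs else 0) =
      (if rk (set bs) = r then (\<Sum>b\<in>span (set bs). \<psi> (f b)) * ?T bs else 0) +
      (case r of 0 \<Rightarrow> 0 | Suc k \<Rightarrow> if rk (set bs) = k then
        ((\<Sum>b\<in>W. \<psi> (f b)) - (\<Sum>b\<in>span (set bs). \<psi> (f b))) * ?T bs else 0)"
    if "bs \<in> L" for bs
  proof -
    let ?S = "span (set bs)"
    have bsW: "set bs \<subseteq> W" and bsV: "set bs \<subseteq> carrier V"
      using that W.subset by (auto simp: L_def)
    have SW: "?S \<subseteq> W"
      using span_is_subset[OF bsW assms] .
    have sum_diff: "(\<Sum>b\<in>W - ?S. \<psi> (f b)) = (\<Sum>b\<in>W. \<psi> (f b)) - (\<Sum>b\<in>?S. \<psi> (f b))"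
      by (rule sum_diff[OF finW SW])
    have "(\<Sum>b\<in>W. if rk (insert b (set bs)) = r then \<psi> (f b) * ?T bs else 0) =
        (\<Sum>b\<in>?S. if rk (insert b (set bs)) = r then \<psi> (f b) * ?T bs else 0) +
        (\<Sum>b\<in>W - ?S. if rk (insert b (set bs)) = r then \<psi> (f b) * ?T bs else 0)"
      by (subst sum.subset_diff[OF SW finW]) simp
    also have "(\<Sum>b\<in>?S. if rk (insert b (set bs)) = r then \<psi> (f b) * ?T bs else 0) =
        (\<Sum>b\<in>?S. if rk (set bs) = r then \<psi> (f b) * ?T bs else 0)"
      using bsV SW W.subset by (intro sum.cong) (auto simp: rk_insert)
    also have "(\<Sum>b\<in>W - ?S. if rk (insert b (set bs)) = r then \<psi> (f b) * ?T bs else 0) =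
        (\<Sum>b\<in>W - ?S. if Suc (rk (set bs)) = r then \<psi> (f b) * ?T bs else 0)"
      using bsV W.subset by (intro sum.cong) (auto simp: rk_insert)
    finally show ?thesis
      by (auto simp: sum_diff[symmetric] sum_distrib_right split: nat.split)
  qed
  \<comment> \<open>The tail comes first in the pair, so that the sum over \<open>b\<close> becomes
    the inner one.\<close>
  have L_Suc: "{bs. set bs \<subseteq> W \<and> length bs = length (f # fs)} = (\<lambda>(bs, b). b # bs) ` (L \<times> W)"
    by (auto simp: L_def length_Suc_conv image_iff)
  have "rank_sum \<psi> (f # fs) W r =
      (\<Sum>bs | set bs \<subseteq> W \<and> length bs = length (f # fs).
        if rk (set bs) = r then prod_list (map2 (\<lambda>f b. \<psi> (f b)) (f # fs) bs) else 0)"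
    unfolding rank_sum_def using finite_lists_length_eq[OF finW]
    by (subst sum.inter_filter[symmetric]) (auto simp: conj_assoc intro!: sum.cong)
  also have "\<dots> = (\<Sum>(bs, b)\<in>L \<times> W. if rk (insert b (set bs)) = r then \<psi> (f b) * ?T bs else 0)"
    unfolding L_Suc by (subst sum.reindex) (auto simp: inj_on_def insert_compr intro!: sum.cong)
  also have "\<dots> = (\<Sum>bs\<in>L. \<Sum>b\<in>W. if rk (insert b (set bs)) = r then \<psi> (f b) * ?T bs else 0)"
    by (rule sum.cartesian_product[symmetric])
  also have "\<dots> = (\<Sum>bs\<in>L.
      (if rk (set bs) = r then (\<Sum>b\<in>span (set bs). \<psi> (f b)) * ?T bs else 0) +
      (case r of 0 \<Rightarrow> 0 | Suc k \<Rightarrow> if rk (set bs) = k then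
        ((\<Sum>b\<in>W. \<psi> (f b)) - (\<Sum>b\<in>span (set bs). \<psi> (f b))) * ?T bs else 0))"
    using inner by (rule sum.cong[OF refl])
  finally show ?thesis
    using finL by (cases r)
      (simp_all add: sum.distrib sum.inter_filter[symmetric] L_def conj_assoc)
qed

text \<open>The kernel of a functional is a submodule, so vanishing on the generators already means
  vanishing on the span; the size is then given by \<open>card_span\<close>.\<close>

lemma sum_character_span:
  assumes \<psi>: "nontrivial_additive_character K \<psi>" and W: "submodule K W V"
    and f: "linear_functional K V f" and S: "S \<subseteq> W"
  shows "(\<Sum>b\<in>span S. \<psi> (f b)) =
    (if S \<subseteq> {w \<in> W. f w = \<zero>\<^bsub>K\<^esub>} then of_nat (q ^ rk S) else 0)"
proof -
  have SV: "S \<subseteq> carrier V"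
    using S submodule.subset[OF W] by (rule subset_trans)
  have "(\<forall>u\<in>span S. f u = \<zero>\<^bsub>K\<^esub>) \<longleftrightarrow> S \<subseteq> {w \<in> W. f w = \<zero>\<^bsub>K\<^esub>}"
  proof
    assume "\<forall>u\<in>span S. f u = \<zero>\<^bsub>K\<^esub>"
    then show "S \<subseteq> {w \<in> W. f w = \<zero>\<^bsub>K\<^esub>}"
      using S in_own_span[OF SV] by (auto dest!: subsetD)
  next
    assume "S \<subseteq> {w \<in> W. f w = \<zero>\<^bsub>K\<^esub>}"
    then have "span S \<subseteq> {w \<in> W. f w = \<zero>\<^bsub>K\<^esub>}"
      by (rule span_is_subset[OF _ submodule_kernel[OF W f]])
    then show "\<forall>u\<in>span S. f u = \<zero>\<^bsub>K\<^esub>"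
      by (auto dest!: subsetD)
  qed
  then show ?thesis
    using sum_character_functional[OF \<psi> span_is_submodule[OF SV] f] card_span[OF SV] by simp
qed

text \<open>All character values are 1, so the inner sums of \<open>rank_sum_Cons\<close> are the
  cardinalities of \<open>W\<close> and of the span of the tail.\<close>

lemma rank_sum_Cons_zero:
  assumes \<psi>: "nontrivial_additive_character K \<psi>" and W: "submodule K W V" "card W = q ^ d"
    and f: "linear_functional K V f" "\<forall>w\<in>W. f w = \<zero>\<^bsub>K\<^esub>"
  shows "rank_sum \<psi> (f # fs) W r = of_nat (q ^ r) * rank_sum \<psi> fs W r +
    (case r of 0 \<Rightarrow> 0 | Suc k \<Rightarrow> (of_nat (q ^ d) - of_nat (q ^ k)) * rank_sum \<psi> fs W k)"
proof -
  have span: "(\<Sum>b\<in>span (set bs). \<psi> (f b)) = of_nat (q ^ rk (set bs))" if "set bs \<subseteq> W" for bs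
    using that f(2) by (subst sum_character_span[OF \<psi> W(1) f(1) that]) auto
  have "(\<Sum>b\<in>W. \<psi> (f b)) = of_nat (q ^ d)"
    using sum_character_functional[OF \<psi> W(1) f(1)] f(2) W(2) by simp
  then show ?thesis
    unfolding rank_sum_Cons[OF W(1)]
    by (cases r) (simp_all add: rank_sum_def sum_distrib_left span)
qed

text \<open>The sum over \<open>W\<close> vanishes, which leaves the span sum with a minus sign in
  the second term.\<close>

lemma rank_sum_Cons_nonzero:
  assumes \<psi>: "nontrivial_additive_character K \<psi>" and W: "submodule K W V"
    and f: "linear_functional K V f" and "\<not> (\<forall>w\<in>W. f w = \<zero>\<^bsub>K\<^esub>)"
  defines "W' \<equiv> {w \<in> W. f w = \<zero>\<^bsub>K\<^esub>}"
  shows "rank_sum \<psi> (f # fs) W r = of_nat (q ^ r) * rank_sum \<psi> fs W' r -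
    (case r of 0 \<Rightarrow> 0 | Suc k \<Rightarrow> of_nat (q ^ k) * rank_sum \<psi> fs W' k)"
proof -
  let ?L = "\<lambda>W k. {bs. set bs \<subseteq> W \<and> length bs = length fs \<and> rk (set bs) = k}"
  let ?T = "\<lambda>bs. prod_list (map2 (\<lambda>f b. \<psi> (f b)) fs bs)"
  have fin: "finite (?L W k)" for k
    by (rule finite_subset[OF _ finite_lists_length_eq[OF finite_submodule[OF W]]]) auto
  have span: "(\<Sum>bs\<in>?L W k. (\<Sum>b\<in>span (set bs). \<psi> (f b)) * ?T bs) =
      of_nat (q ^ k) * rank_sum \<psi> fs W' k" for k
  proof -
    have "(\<Sum>bs\<in>?L W k. (\<Sum>b\<in>span (set bs). \<psi> (f b)) * ?T bs) =
        (\<Sum>bs\<in>?L W k. if set bs \<subseteq> W' then of_nat (q ^ k) * ?T bs else 0)"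
    proof (rule sum.cong[OF refl])
      fix bs assume bs: "bs \<in> ?L W k"
      then have "set bs \<subseteq> W" by simp
      from sum_character_span[OF \<psi> W f this] bs
      show "(\<Sum>b\<in>span (set bs). \<psi> (f b)) * ?T bs = (if set bs \<subseteq> W' then of_nat (q ^ k) * ?T bs else 0)"
        by (simp add: W'_def)
    qed
    \<comment> \<open>Terms whose tail leaves \<open>W'\<close> are zero; discarding them turns the
      sum over lists in \<open>W\<close> into one over lists in \<open>W'\<close>.\<close>
    also have "\<dots> = (\<Sum>bs\<in>{bs \<in> ?L W k. set bs \<subseteq> W'}. of_nat (q ^ k) * ?T bs)"
      by (rule sum.inter_filter[symmetric, OF fin])
    also have "{bs \<in> ?L W k. set bs \<subseteq> W'} = ?L W' k"
      by (auto simp: W'_def)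
    finally show ?thesis
      by (simp add: rank_sum_def sum_distrib_left)
  qed
  have "(\<Sum>b\<in>W. \<psi> (f b)) = 0"
    using sum_character_functional[OF \<psi> W f] by (simp only: assms(4) if_False)
  then show ?thesis
    unfolding rank_sum_Cons[OF W] using span
    by (cases r) (simp_all add: sum_negf)
qed

text \<open>The equation for the size of the common kernel says that the functionals have rank
  \<open>s\<close> on \<open>W\<close>, without a dual space. \<open>W\<close>, \<open>d\<close> and
  \<open>s\<close> vary in the induction because a nonzero functional replaces \<open>W\<close> by
  its kernel.\<close>

theorem rank_sum_eq_poly:
  assumes \<psi>: "nontrivial_additive_character K \<psi>"
  shows "submodule K W V \<Longrightarrow> card W = q ^ d \<Longrightarrow> (\<forall>f\<in>set fs. linear_functional K V f) \<Longrightarrow>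
    q ^ s * card {w \<in> W. \<forall>f\<in>set fs. f w = \<zero>\<^bsub>K\<^esub>} = q ^ d \<Longrightarrow>
    rank_sum \<psi> fs W r = of_int (poly (rank_sum_poly (length fs) d s r) (int q))"
proof (induction fs arbitrary: W d s r)
  case Nil
  have "{bs. set bs \<subseteq> W \<and> length bs = 0 \<and> rk (set bs) = r} = (if r = 0 then {[]} else {})"
    using rk_lin_indpt[of "{}"] by (auto simp: lin_dep_def)
  then show ?case
    by (simp add: rank_sum_def)
next
  case (Cons f fs)
  note W = Cons.prems(1,2)
  have f: "linear_functional K V f" and fs: "\<forall>f\<in>set fs. linear_functional K V f"
    using Cons.prems(3) by simp_all
  let ?W = "{w \<in> W. f w = \<zero>\<^bsub>K\<^esub>}"
  have W_Cons: "{w \<in> W. \<forall>f\<in>set (f # fs). f w = \<zero>\<^bsub>K\<^esub>} = {w \<in> ?W. \<forall>f\<in>set fs. f w = \<zero>\<^bsub>K\<^esub>}"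
    by auto
  show ?case
  proof (cases "\<forall>w\<in>W. f w = \<zero>\<^bsub>K\<^esub>")
    case True
    then have WW: "?W = W" by auto
    \<comment> \<open>Dropping \<open>f\<close> leaves \<open>s\<close> unchanged and possibly
      positive, so the recursion comes from \<open>rank_sum_poly_Suc\<close>; its bounds on
      \<open>s\<close> follow from the size of the common kernel.\<close>
    let ?N = "card {w \<in> W. \<forall>f\<in>set fs. f w = \<zero>\<^bsub>K\<^esub>}"
    have s: "q ^ s * ?N = q ^ d"
      using Cons.prems(4) unfolding W_Cons WW .
    have N: "0 < ?N"
      using s q_gt_1 by (intro Nat.gr0I) auto
    have "q ^ s * ?N \<le> q ^ length fs * ?N"
      using card_common_kernel[OF \<psi> W(1) fs] s W(2) by simp
    then have "s \<le> length fs"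
      using N q_gt_1 by simp
    moreover have "q ^ s * 1 \<le> q ^ s * ?N"
      using N by (intro mult_le_mono2) simp
    then have "q ^ s \<le> q ^ d"
      unfolding s by simp
    then have "s \<le> d"
      using q_gt_1 by simp
    ultimately show ?thesis
      using Cons.IH[OF W fs s]
      by (simp add: rank_sum_Cons_zero[OF \<psi> W f True] rank_sum_poly_Suc poly_monom
        del: rank_sum_poly.simps split: nat.split)
  next
    case False
    then obtain w where w: "w \<in> W" "f w \<noteq> \<zero>\<^bsub>K\<^esub>" by blast
    have card: "q ^ d = q * card ?W"
      using card_kernel[OF \<psi> W(1) f w] W(2) by simp
    have W': "submodule K ?W V"
      by (rule submodule_kernel[OF W(1) f])
    have "d \<noteq> 0"
      using card q_gt_1 by (intro notI) simp
    then obtain e where d: "d = Suc e" by (cases d) auto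
    then have card': "card ?W = q ^ e"
      using card q_gt_1 by simp
    \<comment> \<open>Rank 0 would make the common kernel as large as \<open>W\<close>, yet it lies
      in the kernel of \<open>f\<close>, which has only \<open>q ^ e\<close> elements.\<close>
    have "s \<noteq> 0"
    proof
      assume "s = 0"
      then have "q ^ d = card {w \<in> ?W. \<forall>f\<in>set fs. f w = \<zero>\<^bsub>K\<^esub>}"
        using Cons.prems(4) unfolding W_Cons by simp
      also have "\<dots> \<le> card ?W"
        by (rule card_mono[OF finite_submodule[OF W']]) auto
      finally show False
        using card' d q_gt_1 by simp
    qed
    then obtain t where s: "s = Suc t" by (cases s) auto
    have "q ^ t * card {w \<in> ?W. \<forall>f\<in>set fs. f w = \<zero>\<^bsub>K\<^esub>} = q ^ e"
      using Cons.prems(4) q_gt_1 unfolding W_Cons s d by simp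
    from Cons.IH[OF W' card' fs this] show ?thesis
      by (simp add: rank_sum_Cons_nonzero[OF \<psi> W(1) f False] s d poly_monom split: nat.split)
  qed
qed

text \<open>While fewer than \<open>n\<close> independent vectors are chosen, their span is smaller
  than the space and another vector exists outside it. Zero vectors then pad the list without
  changing the rank.\<close>

lemma ex_list_of_rk:
  assumes V: "card (carrier V) = q ^ n" and "s \<le> n" and "s \<le> m"
  shows "\<exists>bs. set bs \<subseteq> carrier V \<and> length bs = m \<and> rk (set bs) = s"
proof -
  have "\<exists>bs. set bs \<subseteq> carrier V \<and> length bs = s \<and> rk (set bs) = s"
    using \<open>s \<le> n\<close>
  proof (induction s)
    case 0
    then show ?case
      using rk_lin_indpt[of "{}"] by (simp add: lin_dep_def)
  next
    case (Suc s)
    then obtain bs where bs: "set bs \<subseteq> carrier V" "length bs = s" "rk (set bs) = s"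
      by auto
    have "card (span (set bs)) < card (carrier V)"
      using Suc.prems q_gt_1 by (simp add: card_span[OF bs(1)] V bs(3))
    then have "\<not> carrier V \<subseteq> span (set bs)"
      using card_mono[OF finite_submodule[OF span_is_submodule[OF bs(1)]]] by (meson not_less)
    then obtain b where "b \<in> carrier V" "b \<notin> span (set bs)"
      by auto
    then show ?case
      using bs by (intro exI[of _ "b # bs"]) (simp add: rk_insert)
  qed
  then obtain bs where bs: "set bs \<subseteq> carrier V" "length bs = s" "rk (set bs) = s"
    by blast
  have "set (replicate k \<zero>\<^bsub>V\<^esub> @ bs) \<subseteq> carrier V \<and> rk (set (replicate k \<zero>\<^bsub>V\<^esub> @ bs)) = s" for k
    using bs by (induction k) (simp_all add: rk_insert span_zero)
  then show ?thesis
    using bs(2) \<open>s \<le> m\<close> by (intro exI[of _ "replicate (m - s) \<zero>\<^bsub>V\<^esub> @ bs"]) auto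
qed

end

section \<open>Matrices as lists of columns\<close>

lemma field_imp_finite_vectorspace_func_space:
  assumes "field F" and "finite (carrier F)"
  shows "finite_vectorspace F (LinearCombinations.ring.func_space F {..<n::nat})"
proof -
  interpret field F by fact
  show ?thesis
  proof (intro finite_vectorspace.intro vectorspace.intro finite_vectorspace_axioms.intro)
    show "finite (carrier (func_space {..<n}))"
      using assms(2) by (simp add: func_space_def finite_PiE)
  qed (use assms in \<open>simp_all add: func_space_is_module\<close>)
qed

section \<open>Coordinate vectors and the dot product\<close>

locale finite_coordinate_space = field F for F :: "'k ring" (structure) +
  fixes n :: nat
  assumes finite_carrier: "finite (carrier F)"
begin

sublocale V: finite_vectorspace F "func_space {..<n}"
  by (rule field_imp_finite_vectorspace_func_space[OF field_axioms finite_carrier])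

definition dot :: "(nat \<Rightarrow> 'k) \<Rightarrow> (nat \<Rightarrow> 'k) \<Rightarrow> 'k" where
  "dot u v = (\<Oplus>\<^bsub>F\<^esub>i\<in>{..<n}. u i \<otimes>\<^bsub>F\<^esub> v i)"

lemma carrier_func_space: "carrier (func_space {..<n}) = {..<n} \<rightarrow>\<^sub>E carrier F"
  by (simp add: func_space_def)

lemma card_coordinate_space: "card (carrier (func_space {..<n})) = card (carrier F) ^ n"
  by (simp add: carrier_func_space card_PiE)

lemma linear_functional_dot:
  assumes "u \<in> carrier (func_space {..<n})"
  shows "linear_functional F (func_space {..<n}) (dot u)"
proof -
  have u: "u i \<in> carrier F" if "i < n" for i
    using assms that by (auto simp: carrier_func_space)
  show ?thesis
    unfolding linear_functional_def
  proof (intro conjI ballI funcsetI)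
    fix v assume v: "v \<in> carrier (func_space {..<n})"
    have v': "v i \<in> carrier F" if "i < n" for i
      using v that by (auto simp: carrier_func_space)
    show "dot u v \<in> carrier F"
      unfolding dot_def using u v' by (intro finsum_closed) auto
    fix w assume w: "w \<in> carrier (func_space {..<n})"
    have w': "w i \<in> carrier F" if "i < n" for i
      using w that by (auto simp: carrier_func_space)
    have "dot u (v \<oplus>\<^bsub>func_space {..<n}\<^esub> w) =
        (\<Oplus>\<^bsub>F\<^esub>i\<in>{..<n}. u i \<otimes>\<^bsub>F\<^esub> v i \<oplus>\<^bsub>F\<^esub> u i \<otimes>\<^bsub>F\<^esub> w i)"
      unfolding dot_def using u v' w' by (intro finsum_cong') (auto simp: func_space_def r_distr)
    also have "\<dots> = dot u v \<oplus>\<^bsub>F\<^esub> dot u w"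
      unfolding dot_def using u v' w' by (intro finsum_addf) auto
    finally show "dot u (v \<oplus>\<^bsub>func_space {..<n}\<^esub> w) = dot u v \<oplus>\<^bsub>F\<^esub> dot u w" .
  next
    fix c v assume c: "c \<in> carrier F" and v: "v \<in> carrier (func_space {..<n})"
    have v': "v i \<in> carrier F" if "i < n" for i
      using v that by (auto simp: carrier_func_space)
    have "dot u (c \<odot>\<^bsub>func_space {..<n}\<^esub> v) = (\<Oplus>\<^bsub>F\<^esub>i\<in>{..<n}. c \<otimes>\<^bsub>F\<^esub> (u i \<otimes>\<^bsub>F\<^esub> v i))"
      unfolding dot_def using u v' c by (intro finsum_cong') (auto simp: func_space_def m_lcomm)
    also have "\<dots> = c \<otimes>\<^bsub>F\<^esub> dot u v"
      unfolding dot_def using u v' c by (intro finsum_rdistr[symmetric]) auto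
    finally show "dot u (c \<odot>\<^bsub>func_space {..<n}\<^esub> v) = c \<otimes>\<^bsub>F\<^esub> dot u v" .
  qed
qed

lemma dot_commute:
  assumes "u \<in> carrier (func_space {..<n})" and "v \<in> carrier (func_space {..<n})"
  shows "dot u v = dot v u"
proof -
  have "u i \<in> carrier F" "v i \<in> carrier F" if "i < n" for i
    using assms that by (auto simp: carrier_func_space)
  then show ?thesis
    unfolding dot_def by (intro finsum_cong') (auto simp: m_comm)
qed

lemma dot_nondegenerate:
  assumes "u \<in> carrier (func_space {..<n})"
  shows "(\<forall>v\<in>carrier (func_space {..<n}). dot u v = \<zero>\<^bsub>F\<^esub>) \<longleftrightarrow> u = \<zero>\<^bsub>func_space {..<n}\<^esub>"
proof
  have u: "u i \<in> carrier F" if "i < n" for i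
    using assms that by (auto simp: carrier_func_space)
  assume *: "\<forall>v\<in>carrier (func_space {..<n}). dot u v = \<zero>\<^bsub>F\<^esub>"
  have "u i = \<zero>\<^bsub>F\<^esub>" if i: "i < n" for i
  proof -
    let ?e = "\<lambda>j\<in>{..<n}. if j = i then \<one>\<^bsub>F\<^esub> else \<zero>\<^bsub>F\<^esub>"
    have "\<zero>\<^bsub>F\<^esub> = dot u ?e"
      using * by (auto simp: carrier_func_space)
    also have "\<dots> = (\<Oplus>\<^bsub>F\<^esub>j\<in>{..<n}. if i = j then u j else \<zero>\<^bsub>F\<^esub>)"
      unfolding dot_def using u by (intro finsum_cong') auto
    also have "\<dots> = u i"
      using u i by (intro finsum_singleton) auto
    finally show ?thesis by simp
  qed
  then show "u = \<zero>\<^bsub>func_space {..<n}\<^esub>"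
    using assms by (auto simp: func_space_def intro!: ext)
next
  assume "u = \<zero>\<^bsub>func_space {..<n}\<^esub>"
  then show "\<forall>v\<in>carrier (func_space {..<n}). dot u v = \<zero>\<^bsub>F\<^esub>"
    by (metis V.linear_functionalD(4) V.M.zero_closed dot_commute linear_functional_dot)
qed

text \<open>
  Both sides equal \<open>\<Sum>\<^sub>u \<Sum>\<^sub>v \<psi> (dot u v)\<close> with \<open>u\<close> in the span of \<open>S\<close> and \<open>v\<close> in the whole space.
\<close>
lemma card_orthogonal:
  assumes \<psi>: "nontrivial_additive_character F \<psi>" and S: "S \<subseteq> carrier (func_space {..<n})"
  shows "card (carrier F) ^ V.rk S *
    card {v \<in> carrier (func_space {..<n}). \<forall>u\<in>S. dot u v = \<zero>\<^bsub>F\<^esub>} = card (carrier F) ^ n"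
proof -
  let ?V = "carrier (func_space {..<n})"
  let ?S = "V.span S"
  have sub: "submodule F ?S (func_space {..<n})"
    by (rule V.span_is_submodule[OF S])
  have SV: "?S \<subseteq> ?V"
    by (rule submodule.subset[OF sub])
  have full: "submodule F ?V (func_space {..<n})"
    by (rule submodule.intro[OF V.module_axioms]) auto
  have zero: "\<zero>\<^bsub>func_space {..<n}\<^esub> \<in> ?S"
    by (rule V.span_zero)
  \<comment> \<open>With \<open>v\<close> as the fixed argument, orthogonality to \<open>S\<close>
    passes to its span through the kernel of a functional.\<close>
  have orth: "(\<forall>u\<in>?S. dot v u = \<zero>\<^bsub>F\<^esub>) \<longleftrightarrow> (\<forall>u\<in>S. dot u v = \<zero>\<^bsub>F\<^esub>)" if v: "v \<in> ?V" for v
  proof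
    assume "\<forall>u\<in>?S. dot v u = \<zero>\<^bsub>F\<^esub>"
    then show "\<forall>u\<in>S. dot u v = \<zero>\<^bsub>F\<^esub>"
      using V.in_own_span[OF S] S v by (metis dot_commute subsetD)
  next
    assume "\<forall>u\<in>S. dot u v = \<zero>\<^bsub>F\<^esub>"
    then have "S \<subseteq> {u \<in> ?V. dot v u = \<zero>\<^bsub>F\<^esub>}"
      using S v by (auto simp: dot_commute dest: subsetD)
    from V.span_is_subset[OF this V.submodule_kernel[OF full linear_functional_dot[OF v]]]
    show "\<forall>u\<in>?S. dot v u = \<zero>\<^bsub>F\<^esub>" by (auto dest: subsetD)
  qed
  have "of_nat (card (carrier F) ^ n) = (\<Sum>u\<in>?S. if u = \<zero>\<^bsub>func_space {..<n}\<^esub> then of_nat (card ?V) else (0 :: complex))"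
    using zero V.finite_submodule[OF sub] by (simp add: card_coordinate_space)
  \<comment> \<open>By nondegeneracy only the zero vector is orthogonal to the whole space, so every
    other inner sum is 0.\<close>
  also have "\<dots> = (\<Sum>u\<in>?S. \<Sum>v\<in>?V. \<psi> (dot u v))"
  proof (rule sum.cong[OF refl])
    fix u assume "u \<in> ?S"
    then have u: "u \<in> ?V" by (rule subsetD[OF SV])
    show "(if u = \<zero>\<^bsub>func_space {..<n}\<^esub> then of_nat (card ?V) else 0) = (\<Sum>v\<in>?V. \<psi> (dot u v))"
      unfolding V.sum_character_functional[OF \<psi> full linear_functional_dot[OF u]]
        dot_nondegenerate[OF u] by (rule refl)
  qed
  also have "\<dots> = (\<Sum>v\<in>?V. \<Sum>u\<in>?S. \<psi> (dot u v))"
    by (rule sum.swap)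
  also have "\<dots> = (\<Sum>v\<in>?V. \<Sum>u\<in>?S. \<psi> (dot v u))"
    using SV by (intro sum.cong refl arg_cong[of _ _ \<psi>] dot_commute) (auto dest: subsetD)
  also have "\<dots> = (\<Sum>v\<in>?V. if \<forall>u\<in>S. dot u v = \<zero>\<^bsub>F\<^esub> then of_nat (card ?S) else 0)"
  proof (rule sum.cong[OF refl])
    fix v assume v: "v \<in> ?V"
    show "(\<Sum>u\<in>?S. \<psi> (dot v u)) = (if \<forall>u\<in>S. dot u v = \<zero>\<^bsub>F\<^esub> then of_nat (card ?S) else 0)"
      unfolding V.sum_character_functional[OF \<psi> sub linear_functional_dot[OF v]] orth[OF v]
      by (rule refl)
  qed
  also have "\<dots> = of_nat (card ?S * card {v \<in> ?V. \<forall>u\<in>S. dot u v = \<zero>\<^bsub>F\<^esub>})"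
    using V.finite_space by (simp flip: sum.inter_filter)
  finally show ?thesis
    by (simp only: of_nat_eq_iff V.card_span[OF S])
qed

end

section \<open>Column lists and the character of the pairing\<close>

definition column_list :: "'k mat \<Rightarrow> (nat \<Rightarrow> 'k) list" where
  "column_list a = map (\<lambda>j. \<lambda>i\<in>{..<dim_row a}. a $$ (i, j)) [0..<dim_col a]"

context finite_coordinate_space
begin

lemma Mat_entry: "a \<in> Mat F n m \<Longrightarrow> i < n \<Longrightarrow> j < m \<Longrightarrow> a $$ (i, j) \<in> carrier F"
  unfolding Mat_def by (auto simp: elements_mat_def UN_subset_iff image_subset_iff)

lemma Mat_dim: "a \<in> Mat F n m \<Longrightarrow> dim_row a = n" "a \<in> Mat F n m \<Longrightarrow> dim_col a = m"
  unfolding Mat_def by auto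

lemma bij_betw_column_list:
  "bij_betw column_list (Mat F n m) {bs. set bs \<subseteq> carrier (func_space {..<n}) \<and> length bs = m}"
proof (rule bij_betwI[where g = "\<lambda>bs. mat n m (\<lambda>(i, j). (bs ! j) i)"])
  show "column_list \<in> Mat F n m \<rightarrow> {bs. set bs \<subseteq> carrier (func_space {..<n}) \<and> length bs = m}"
    by (auto simp: column_list_def Mat_dim Mat_entry carrier_func_space split: if_splits)
  show "(\<lambda>bs. mat n m (\<lambda>(i, j). (bs ! j) i)) \<in>
      {bs. set bs \<subseteq> carrier (func_space {..<n}) \<and> length bs = m} \<rightarrow> Mat F n m"
  proof (intro funcsetI)
    fix bs assume bs: "bs \<in> {bs. set bs \<subseteq> carrier (func_space {..<n}) \<and> length bs = m}"
    have "(bs ! j) i \<in> carrier F" if "i < n" "j < m" for i j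
    proof -
      have "bs ! j \<in> carrier (func_space {..<n})"
        using bs that by (auto intro: subsetD nth_mem)
      then show ?thesis
        using that by (auto simp: carrier_func_space)
    qed
    then show "mat n m (\<lambda>(i, j). (bs ! j) i) \<in> Mat F n m"
      by (auto simp: Mat_def elements_mat_def)
  qed
  show "mat n m (\<lambda>(i, j). (column_list a ! j) i) = a" if "a \<in> Mat F n m" for a
    using that by (intro eq_matI) (auto simp: column_list_def Mat_dim)
  show "column_list (mat n m (\<lambda>(i, j). (bs ! j) i)) = bs"
    if "bs \<in> {bs. set bs \<subseteq> carrier (func_space {..<n}) \<and> length bs = m}" for bs
  proof (rule nth_equalityI)
    fix j assume "j < length (column_list (mat n m (\<lambda>(i, j). (bs ! j) i)))"
    then have j: "j < m" by (simp add: column_list_def)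
    have "bs ! j \<in> carrier (func_space {..<n})"
      using that j by (auto intro: subsetD nth_mem)
    \<comment> \<open>Outside the index range both columns are \<open>undefined\<close>, so
      agreement of the entries gives equality as functions.\<close>
    then have "bs ! j \<in> extensional {..<n}"
      by (auto simp: carrier_func_space PiE_def)
    then show "column_list (mat n m (\<lambda>(i, j). (bs ! j) i)) ! j = bs ! j"
      using j by (auto simp: column_list_def extensional_def)
  qed (use that in \<open>simp add: column_list_def\<close>)
qed

lemma rank_over_eq_rk_column_list:
  assumes "a \<in> Mat F n m"
  shows "rank_over F a = V.rk (set (column_list a))"
  using assms by (simp add: rank_over_def column_space_def V.rk_def column_list_def Mat_dim atLeast0LessThan)

lemma additive_character_finsum:
  assumes \<psi>: "nontrivial_additive_character F \<psi>" and "finite A" and "g \<in> A \<rightarrow> carrier F"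
  shows "\<psi> (\<Oplus>\<^bsub>F\<^esub>i\<in>A. g i) = (\<Prod>i\<in>A. \<psi> (g i))"
  using assms(2,3)
proof (induction A rule: finite_induct)
  case empty
  show ?case
    by (simp add: V.additive_character_zero[OF \<psi>])
next
  case (insert x A)
  then have "g x \<in> carrier F" and g: "g \<in> A \<rightarrow> carrier F" and "(\<Oplus>\<^bsub>F\<^esub>i\<in>A. g i) \<in> carrier F"
    by (auto intro: finsum_closed)
  then show ?case
    using insert.hyps insert.IH[OF g] \<psi>
    by (simp add: nontrivial_additive_character_def)
qed

text \<open>The j-th diagonal entry of the product in \<open>pairing\<close> is the dot product of
  the j-th columns, and the character turns the sum over j into a product.\<close>

lemma character_pairing:
  assumes \<psi>: "nontrivial_additive_character F \<psi>" and a: "a \<in> Mat F n m" and b: "b \<in> Mat F n m"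
  shows "\<psi> (pairing F a b) = prod_list (map2 (\<lambda>f v. \<psi> (f v)) (map dot (column_list a)) (column_list b))"
proof -
  let ?d = "\<lambda>j. \<Oplus>\<^bsub>F\<^esub>i\<in>{..<n}. a $$ (i, j) \<otimes>\<^bsub>F\<^esub> b $$ (i, j)"
  have d: "?d j \<in> carrier F" if "j < m" for j
    using that a b by (intro finsum_closed) (auto simp: Mat_entry)
  have "pairing F a b = (\<Oplus>\<^bsub>F\<^esub>j\<in>{..<m}. ?d j)"
    unfolding pairing_def trace_over_def using a b d
    by (intro finsum_cong') (auto simp: mat_mult_over_def Mat_dim Mat_entry intro!: finsum_cong')
  then have "\<psi> (pairing F a b) = (\<Prod>j<m. \<psi> (?d j))"
    using d by (simp add: additive_character_finsum[OF \<psi>])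
  also have "\<dots> = (\<Prod>j<m. \<psi> (dot (column_list a ! j) (column_list b ! j)))"
  proof (rule prod.cong[OF refl])
    fix j assume "j \<in> {..<m}"
    then have "?d j = dot (column_list a ! j) (column_list b ! j)"
      unfolding dot_def using a b
      by (intro finsum_cong') (auto simp: column_list_def Mat_dim Mat_entry)
    then show "\<psi> (?d j) = \<psi> (dot (column_list a ! j) (column_list b ! j))" by simp
  qed
  also have "\<dots> = prod_list (map2 (\<lambda>f v. \<psi> (f v)) (map dot (column_list a)) (column_list b))"
    using a b by (simp add: prod.list_conv_set_nth column_list_def Mat_dim atLeast0LessThan)
  finally show ?thesis .
qed

text \<open>This is \<open>rank_sum_eq_poly\<close> on the whole space; the \<open>m\<close> columns
  are vectors in dimension \<open>n\<close>, whence the order of the arguments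
  \<open>m n\<close>.\<close>

lemma sum_character_pairing:
  assumes \<psi>: "nontrivial_additive_character F \<psi>" and a: "a \<in> Mat F n m"
  shows "(\<Sum>b | b \<in> Mat F n m \<and> rank_over F b = r. \<psi> (pairing F a b)) =
    of_int (poly (rank_sum_poly m n (rank_over F a) r) (int (card (carrier F))))"
proof -
  let ?V = "carrier (func_space {..<n})"
  let ?T = "\<lambda>bs. prod_list (map2 (\<lambda>f v. \<psi> (f v)) (map dot (column_list a)) bs)"
  have colV: "set (column_list a) \<subseteq> ?V" and len: "length (column_list a) = m"
    using bij_betw_column_list[of m] a by (auto simp: bij_betw_def)
  have "bij_betw column_list {b \<in> Mat F n m. rank_over F b = r}
      {bs. set bs \<subseteq> ?V \<and> length bs = m \<and> V.rk (set bs) = r}"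
    using bij_betw_Collect[OF bij_betw_column_list[of m], of "\<lambda>bs. V.rk (set bs) = r" "\<lambda>b. rank_over F b = r"]
    by (simp add: rank_over_eq_rk_column_list)
  then have "(\<Sum>bs | set bs \<subseteq> ?V \<and> length bs = m \<and> V.rk (set bs) = r. ?T bs) =
      (\<Sum>b | b \<in> Mat F n m \<and> rank_over F b = r. ?T (column_list b))"
    by (rule sum.reindex_bij_betw[symmetric])
  also have "\<dots> = (\<Sum>b | b \<in> Mat F n m \<and> rank_over F b = r. \<psi> (pairing F a b))"
    by (intro sum.cong refl) (simp add: character_pairing[OF \<psi> a])
  finally have "(\<Sum>b | b \<in> Mat F n m \<and> rank_over F b = r. \<psi> (pairing F a b)) =
      V.rank_sum \<psi> (map dot (column_list a)) ?V r"
    by (simp add: V.rank_sum_def len)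
  also have "\<dots> = of_int (poly (rank_sum_poly (length (map dot (column_list a))) n (rank_over F a) r) (int (card (carrier F))))"
  proof (rule V.rank_sum_eq_poly[OF \<psi>])
    show "submodule F ?V (func_space {..<n})"
      by (rule submodule.intro[OF V.module_axioms]) auto
    show "\<forall>f\<in>set (map dot (column_list a)). linear_functional F (func_space {..<n}) f"
      using colV by (auto intro!: linear_functional_dot dest: subsetD)
    \<comment> \<open>The common kernel is the orthogonal complement of the columns of
      \<open>a\<close>, so the functionals have the rank of \<open>a\<close>.\<close>
    show "card (carrier F) ^ rank_over F a *
        card {w \<in> ?V. \<forall>f\<in>set (map dot (column_list a)). f w = \<zero>\<^bsub>F\<^esub>} = card (carrier F) ^ n"
      using card_orthogonal[OF \<psi> colV] by (simp add: rank_over_eq_rk_column_list[OF a])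
  qed (rule card_coordinate_space)
  finally show ?thesis
    by (simp add: len)
qed

lemma ex_Mat_of_rank:
  assumes "s \<le> n" and "s \<le> m"
  shows "\<exists>a\<in>Mat F n m. rank_over F a = s"
proof -
  obtain bs where bs: "set bs \<subseteq> carrier (func_space {..<n})" "length bs = m" "V.rk (set bs) = s"
    using V.ex_list_of_rk[OF card_coordinate_space assms] by blast
  then have "bs \<in> column_list ` Mat F n m"
    using bij_betw_column_list[of m] by (simp add: bij_betw_def)
  then show ?thesis
    using bs(3) by (auto simp: rank_over_eq_rk_column_list)
qed

end

section \<open>The canonical matrix as a value of the polynomial\<close>

lemma canonical_matrix_eq_poly:
  fixes F :: "'k ring"
  assumes "field F" and "finite (carrier F)" and \<theta>: "nontrivial_additive_character F \<theta>"
    and s: "s \<le> n" "s \<le> m"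
  shows "canonical_matrix F \<theta> n m s r = of_int (poly (rank_sum_poly m n s r) (int (card (carrier F))))"
proof -
  interpret finite_coordinate_space F n
    by (intro finite_coordinate_space.intro finite_coordinate_space_axioms.intro assms)
  \<comment> \<open>The conjugate of \<theta> is again a nontrivial character and takes the place of
    \<psi>.\<close>
  have "nontrivial_additive_character F (\<lambda>x. cnj (\<theta> x))"
    using \<theta> by (simp add: nontrivial_additive_character_def)
  note sum = sum_character_pairing[OF this]
  \<comment> \<open>Without a matrix of rank \<open>s\<close>, every \<open>z\<close> would satisfy
    the condition under \<open>THE\<close>; this witness gives uniqueness.\<close>
  obtain a where a: "a \<in> Mat F n m" "rank_over F a = s"
    using ex_Mat_of_rank[OF s] by blast
  show ?thesis
    unfolding canonical_matrix_def
  proof (rule the_equality)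
    show "\<forall>a\<in>Mat F n m. rank_over F a = s \<longrightarrow>
        (\<Sum>b | b \<in> Mat F n m \<and> rank_over F b = r. cnj (\<theta> (pairing F a b))) =
        of_int (poly (rank_sum_poly m n s r) (int (card (carrier F))))"
      by (simp add: sum)
  next
    fix z
    assume "\<forall>a\<in>Mat F n m. rank_over F a = s \<longrightarrow>
        (\<Sum>b | b \<in> Mat F n m \<and> rank_over F b = r. cnj (\<theta> (pairing F a b))) = z"
    then show "z = of_int (poly (rank_sum_poly m n s r) (int (card (carrier F))))"
      using a sum[OF a(1), of r] by simp
  qed
qed

text \<open>The conjunct over \<open>nat\<close> covers every finite field up to isomorphism. Its
  infinitely many orders determine \<open>p\<close>, so \<open>p\<close> is the same whatever the
  type \<open>'k\<close> is.\<close>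

theorem corollary5p2p2:
  fixes n m s r :: nat
  assumes "n \<le> m" and "s \<le> n" and "r \<le> n"
  shows "\<exists>p :: int poly.
    (\<forall>(F :: nat ring) \<theta>. field F \<longrightarrow> finite (carrier F) \<longrightarrow> nontrivial_additive_character F \<theta> \<longrightarrow>
       canonical_matrix F \<theta> n m s r = of_int (poly p (int (card (carrier F))))) \<and>
    (\<forall>(F :: 'k ring) \<theta>. field F \<longrightarrow> finite (carrier F) \<longrightarrow> nontrivial_additive_character F \<theta> \<longrightarrow>
       canonical_matrix F \<theta> n m s r = of_int (poly p (int (card (carrier F))))) \<and>
    ((\<lambda>x :: real. poly (map_poly real_of_int p) x) \<longlongrightarrow>
       (if r \<le> s then (-1) ^ r * real (s choose r) else 0)) (at 1)"
proof (intro exI[of _ "rank_sum_poly m n s r"] conjI allI impI)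
  let ?p = "rank_sum_poly m n s r"
  have s: "s \<le> m" using assms by simp
  show "canonical_matrix F \<theta> n m s r = of_int (poly ?p (int (card (carrier F))))"
    if "field F" "finite (carrier F)" "nontrivial_additive_character F \<theta>" for F :: "nat ring" and \<theta>
    by (rule canonical_matrix_eq_poly[OF that assms(2) s])
  show "canonical_matrix F \<theta> n m s r = of_int (poly ?p (int (card (carrier F))))"
    if "field F" "finite (carrier F)" "nontrivial_additive_character F \<theta>" for F :: "'k ring" and \<theta>
    by (rule canonical_matrix_eq_poly[OF that assms(2) s])
  \<comment> \<open>By continuity the limit is the value at 1; for \<open>r > s\<close> the binomial
    coefficient is already 0.\<close>
  have "poly (map_poly real_of_int p) 1 = of_int (poly p 1)" for p
    by (induction p) (simp_all add: map_poly_pCons)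
  then have "poly (map_poly real_of_int ?p) 1 = (if r \<le> s then (-1) ^ r * real (s choose r) else 0)"
    by (simp add: poly_rank_sum_poly_1[OF s] binomial_eq_0)
  then show "((\<lambda>x :: real. poly (map_poly real_of_int ?p) x) \<longlongrightarrow>
       (if r \<le> s then (-1) ^ r * real (s choose r) else 0)) (at 1)"
    by (metis isCont_def poly_isCont)
qed

end
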